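(* Let $p$ be a prime and let $A\subseteq\mathbb{F}_p^*$ with $1\in A$. Assume that $|A+A|=K|A|$ with $K>0$ and that $|A|>\dfrac{p^{3/4}}{K^{1/4}}$. Then $|A^3|>\dfrac{p}{2K}$, and there is a subgroup $G\le\mathbb{F}_p^*$ such that $A^{\lceil 12K\rceil}=G$. In particular, if $A$ is a generating subset of $\mathbb{F}_p^*$, then $A^{\lceil 12K\rceil}=\mathbb{F}_p^*$.
   Context: For a prime $p$, $\mathbb{F}_p$ is the field with $p$ elements and $\mathbb{F}_p^*=\mathbb{F}_p\setminus\{0\}$ is its multiplicative group. $A+A=\{a+a':a,a'\in A\}$ is the sumset in $\mathbb{F}_p$. For an integer $k\ge1$, $A^k=\{a_1a_2\cdots a_k: a_1,\dots,a_k\in A\}$ is the $k$-fold product set. A subset $A$ of $\mathbb{F}_p^*$ is generating if the multiplicative subgroup it generates is all of $\mathbb{F}_p^*$. The subgroup $G$ is not required to be proper. *)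

theory Defs
  imports Complex_Main "HOL-Number_Theory.Residues"
begin

abbreviation Fp :: "nat \<Rightarrow> int ring"
  where "Fp p \<equiv> residue_ring (int p)"

abbreviation Fp_star :: "nat \<Rightarrow> int monoid"
  where "Fp_star p \<equiv> mult_of (Fp p)"

(* The factors need not be distinct: a ranges over all k-tuples of elements of A. *)
definition prod_power :: "('a, 'b) monoid_scheme \<Rightarrow> 'a set \<Rightarrow> nat \<Rightarrow> 'a set"
  where "prod_power G A k = {(\<Otimes>\<^bsub>G\<^esub>i\<in>{1..k}. a i) | a. a \<in> {1..k} \<rightarrow> A}"

definition generating :: "('a, 'b) monoid_scheme \<Rightarrow> 'a set \<Rightarrow> bool"
  where "generating G A \<longleftrightarrow> A \<subseteq> carrier G \<and> generate G A = carrier G"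

end

theory Submission
  imports Defs "HOL-Analysis.Convex"
begin

text \<open>
  Write \<open>n = |A|\<close>, \<open>S = A + A\<close>, \<open>P = A A\<close>. Both conclusions come from the single inequality
  \<open>|P| > p / (2 K)\<close>. As \<open>1 \<in> A\<close>, the set \<open>A\<^sup>3\<close> contains \<open>P\<close>, which gives the first
  conclusion.

  The inequality is a sum-product estimate. For \<open>a, b \<in> A\<close> the line
  \<open>{(s, (s - a) b)}\<close> in the affine plane passes through the \<open>n\<close> points \<open>(a + x, x b)\<close> with
  \<open>x \<in> A\<close>, all of which lie in \<open>S \<times> P\<close>. So \<open>n\<^sup>2\<close> lines meet \<open>S \<times> P\<close> in at least \<open>n\<^sup>3\<close>
  incidences, whereas a variance computation (\<open>incidence_bound\<close>) shows that this number
  differs from its expected value \<open>|S| |P| n\<^sup>2 / p\<close> by at most \<open>n (p |S| |P|)\<^bsup>1/2\<^esup>\<close>. If \<open>|P|\<close> were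
  at most \<open>p / (2 K)\<close>, the expected value would be at most \<open>n\<^sup>3 / 2\<close> and the error would
  force \<open>n\<^sup>3 \<le> 2 p\<^sup>2\<close>. But \<open>n \<le> |P|\<close> then also gives \<open>K n \<le> p / 2\<close>, and together with the
  hypothesis \<open>K n\<^sup>4 > p\<^sup>3\<close> this yields \<open>n\<^sup>3 > 2 p\<^sup>2\<close>.

  For the second conclusion let \<open>G\<close> be the group generated by \<open>A\<close>. By Hamidoune's
  isoperimetric method (\<open>minimal_growth_attained_by_subgroup\<close>) each multiplication of a set
  \<open>X\<close> by \<open>P\<close> adds at least \<open>|P| / 2\<close> elements until all of \<open>G\<close> is reached. Hence, as long as
  \<open>A\<^bsup>2m\<^esup>\<close> differs from \<open>G\<close>, it has at least \<open>(m + 1) |P| / 2 > (m + 1) p / (4 K)\<close> elements,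
  which is impossible for \<open>m = \<lceil>4 K\<rceil>\<close>; and \<open>2 \<lceil>4 K\<rceil> \<le> 12 K\<close> because \<open>K \<ge> 1\<close>.
\<close>

section \<open>Growth of product sets in finite abelian groups\<close>

lemma (in group) card_translate:
  assumes "x \<in> carrier G" "X \<subseteq> carrier G"
  shows "card ({x} <#> X) = card X"
proof -
  have "{x} <#> X = (\<lambda>y. x \<otimes> y) ` X" by (auto simp: set_mult_def)
  moreover have "inj_on (\<lambda>y. x \<otimes> y) X" using assms by (auto simp: inj_on_def subset_iff)
  ultimately show ?thesis by (simp add: card_image)
qed

lemma (in group) card_le_card_set_mult:
  assumes "finite (carrier G)" "X \<subseteq> carrier G" "B \<subseteq> carrier G" "B \<noteq> {}"
  shows "card X \<le> card (X <#> B)"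
proof -
  obtain b where b: "b \<in> B" using assms by auto
  have "inj_on (\<lambda>y. y \<otimes> b) X" using assms b by (auto simp: inj_on_def subset_iff)
  moreover have "(\<lambda>y. y \<otimes> b) ` X \<subseteq> X <#> B" using b by (auto simp: set_mult_def)
  ultimately show ?thesis
    using assms set_mult_closed[of X B] finite_subset by (metis card_inj_on_le)
qed

text \<open>
  Call \<open>X\<close> admissible if it is nonempty and \<open>X B\<close> is not the whole group, and consider among
  the admissible sets minimising \<open>|X B| - |X|\<close> one of least size (an \<open>atom\<close> in Hamidoune's
  terminology). Translates of an atom are atoms, and distinct atoms are disjoint. So if \<open>H\<close>
  is the translate containing \<open>1\<close> and \<open>x \<in> H\<close>, then \<open>x H\<close> and \<open>H\<close> are atoms sharing \<open>x\<close>, hence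
  equal, and \<open>H\<close> is a subgroup.
\<close>

lemma (in comm_group) minimal_growth_attained_by_subgroup:
  assumes fin: "finite (carrier G)" and B: "B \<subseteq> carrier G" "B \<noteq> {}"
    and X0: "X\<^sub>0 \<subseteq> carrier G" "X\<^sub>0 \<noteq> {}" "X\<^sub>0 <#> B \<noteq> carrier G"
  shows "\<exists>H. subgroup H G \<and> H <#> B \<noteq> carrier G \<and>
    card (H <#> B) + card X\<^sub>0 \<le> card (X\<^sub>0 <#> B) + card H"
proof -
  define adm where "adm X \<longleftrightarrow> X \<subseteq> carrier G \<and> X \<noteq> {} \<and> X <#> B \<noteq> carrier G" for X
  define d where "d X = card (X <#> B) - card X" for X
  have le: "card X \<le> card (X <#> B)" if "X \<subseteq> carrier G" for X
    using card_le_card_set_mult fin that B by blast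
  have finXB: "finite (X <#> B)" "X <#> B \<subseteq> carrier G" if "X \<subseteq> carrier G" for X
    using set_mult_closed[OF that B(1)] fin finite_subset by auto
  have "adm X\<^sub>0" using X0 by (simp add: adm_def)
  then obtain M where M: "adm M" "\<And>Y. adm Y \<Longrightarrow> d M \<le> d Y"
    using ex_has_least_nat[of adm X\<^sub>0 d] by blast
  then obtain F where F: "adm F" "d F = d M"
      and Fmin: "\<And>Y. adm Y \<Longrightarrow> d Y = d M \<Longrightarrow> card F \<le> card Y"
    using ex_has_least_nat[of "\<lambda>X. adm X \<and> d X = d M" M card] by blast
  have dF: "d F \<le> d Y" if "adm Y" for Y using M F that by auto
  have Fc: "F \<subseteq> carrier G" "F \<noteq> {}" "F <#> B \<noteq> carrier G" using F by (auto simp: adm_def)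
  have finF: "finite F" using Fc fin finite_subset by auto

  have tr: "{x} <#> X \<subseteq> carrier G \<and> card ({x} <#> X) = card X \<and>
      card (({x} <#> X) <#> B) = card (X <#> B)" if "x \<in> carrier G" "X \<subseteq> carrier G" for x X
    using that B set_mult_closed set_mult_assoc[of "{x}" X B]
    by (auto simp: card_translate)

  \<comment> \<open>Duality: the set \<open>Y\<close> of inverses of the complement of \<open>F B\<close> is admissible and grows by no
    more than \<open>F\<close>, because \<open>Y B\<close> avoids the inverses of \<open>F\<close>. So \<open>Y\<close> is a minimiser too, and
    \<open>F\<close> is no larger than \<open>Y\<close>.\<close>
  have small: "card F + card (F <#> B) \<le> card (carrier G)"
  proof -
    define Y where "Y = m_inv G ` (carrier G - (F <#> B))"
    have Yc: "Y \<subseteq> carrier G" by (auto simp: Y_def)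
    have ii: "inj_on (m_inv G) (carrier G)" by (auto simp: inj_on_def)
    have cY: "card Y = card (carrier G) - card (F <#> B)"
      unfolding Y_def using finXB[OF Fc(1)]
      by (subst card_image) (auto intro: inj_on_subset[OF ii] simp: card_Diff_subset)
    have YB: "Y <#> B \<subseteq> carrier G - m_inv G ` F"
    proof
      fix u assume "u \<in> Y <#> B"
      then obtain z b where z: "z \<in> carrier G" "z \<notin> F <#> B" "b \<in> B" "u = inv z \<otimes> b"
        by (auto simp: Y_def set_mult_def)
      have bc: "b \<in> carrier G" using z B by auto
      have "u \<noteq> inv f" if "f \<in> F" for f
      proof
        assume "u = inv f"
        have fc: "f \<in> carrier G" using that Fc by auto
        have "inv z \<otimes> b = inv f" using \<open>u = inv f\<close> z by simp
        then have "b \<otimes> inv z = inv f" using m_comm bc z by simp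
        then have "b = inv f \<otimes> z"
          using bc fc z(1) by (metis inv_closed inv_solve_right')
        then have "z = f \<otimes> b" using bc fc z(1) by (simp flip: m_assoc)
        then have "z \<in> F <#> B" using that z(3) by (auto simp: set_mult_def)
        then show False using z by simp
      qed
      then show "u \<in> carrier G - m_inv G ` F" using z bc by auto
    qed
    have cF: "card (m_inv G ` F) = card F"
      by (rule card_image) (use inj_on_subset[OF ii Fc(1)] in auto)
    have "m_inv G ` F \<subseteq> carrier G" using Fc by auto
    then have cYB: "card (Y <#> B) \<le> card (carrier G) - card F"
      using card_mono[OF _ YB] fin cF finF by (simp add: card_Diff_subset)
    have "adm Y"
    proof -
      have "Y \<noteq> {}" using finXB[OF Fc(1)] Fc(3) by (auto simp: Y_def)
      moreover have "Y <#> B \<noteq> carrier G"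
        using YB Fc \<open>m_inv G ` F \<subseteq> carrier G\<close> by blast
      ultimately show ?thesis using Yc by (simp add: adm_def)
    qed
    have cc: "card (F <#> B) \<le> card (carrier G)" "card F \<le> card (carrier G)"
      using finXB[OF Fc(1)] Fc fin by (auto intro: card_mono)
    have "d Y \<le> d F" unfolding d_def using cY cYB le[OF Fc(1)] cc by linarith
    then have "d Y = d M" using dF[OF \<open>adm Y\<close>] F by simp
    then have "card F \<le> card Y" using Fmin \<open>adm Y\<close> by blast
    then show ?thesis using cY cc by linarith
  qed

  \<comment> \<open>Submodularity of \<open>|X B|\<close>: if \<open>Z\<close> and \<open>F\<close> meet, their union is still admissible by the
    bound \<open>small\<close>, so their intersection is a minimiser as well and cannot be smaller than \<open>F\<close>.\<close>
  have atoms: "Z = F" if Z: "Z \<subseteq> carrier G" "card Z = card F" "card (Z <#> B) = card (F <#> B)"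
     and meet: "Z \<inter> F \<noteq> {}" for Z
  proof -
    let ?I = "Z \<inter> F" and ?U = "Z \<union> F"
    have finZ: "finite Z" using Z(1) fin finite_subset by auto
    have Ic: "?I \<subseteq> carrier G" and Uc: "?U \<subseteq> carrier G" using Fc Z by auto
    have sub: "?I <#> B \<subseteq> (Z <#> B) \<inter> (F <#> B)" by (auto simp: set_mult_def)
    have un: "?U <#> B = (Z <#> B) \<union> (F <#> B)" by (auto simp: set_mult_def)
    have "?I <#> B \<noteq> carrier G" using sub finXB[OF Fc(1)] Fc(3) by auto
    then have admI: "adm ?I" using Ic meet by (simp add: adm_def)
    have subm: "card (?I <#> B) + card (?U <#> B) \<le> 2 * card (F <#> B)"
    proof -
      have "card (?I <#> B) \<le> card ((Z <#> B) \<inter> (F <#> B))"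
        using sub finXB[OF Fc(1)] by (auto intro: card_mono)
      then show ?thesis
        using card_Un_Int[OF finXB(1)[OF Z(1)] finXB(1)[OF Fc(1)]] un Z(3) by simp
    qed
    have IU: "card ?I + card ?U = 2 * card F"
      using card_Un_Int[OF finZ finF] Z(2) by simp
    have Ipos: "card ?I > 0" using meet finF by (simp add: card_gt_0_iff)
    have I1: "d F + card ?I \<le> card (?I <#> B)"
      using dF[OF admI] le[OF Ic] unfolding d_def by linarith
    have dFe: "card (F <#> B) = d F + card F" using le[OF Fc(1)] by (simp add: d_def)
    have "card (?U <#> B) < card (carrier G)"
      using subm I1 dFe small Ipos by linarith
    then have admU: "adm ?U" using Uc Fc by (auto simp: adm_def)
    have U1: "d F + card ?U \<le> card (?U <#> B)"
      using dF[OF admU] le[OF Uc] unfolding d_def by linarith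
    have "d ?I = d M" using subm U1 dFe IU dF[OF admI] le[OF Ic] F(2) unfolding d_def by linarith
    then have "card F \<le> card ?I" using Fmin admI by blast
    then have "?I = F" using finF by (metis card_seteq inf_le2)
    moreover have "?I = Z" using \<open>card F \<le> card ?I\<close> Z(2) finZ by (metis card_seteq inf_le1)
    ultimately show ?thesis by simp
  qed

  obtain f where f: "f \<in> F" using Fc by auto
  define H where "H = {inv f} <#> F"
  have fc: "f \<in> carrier G" using f Fc by auto
  have H: "H \<subseteq> carrier G" "card H = card F" "card (H <#> B) = card (F <#> B)"
    using tr[of "inv f" F] fc Fc by (auto simp: H_def)
  have FH: "F = {f} <#> H"
  proof -
    have "{f} <#> H = ({f} <#> {inv f}) <#> F"
      unfolding H_def using Fc fc by (simp add: set_mult_assoc)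
    also have "{f} <#> {inv f} = {\<one>}" using fc by (simp add: set_mult_def)
    also have "{\<one>} <#> F = F"
      using Fc by (simp add: lcos_mult_one flip: l_coset_eq_set_mult)
    finally show ?thesis by simp
  qed
  have oneH: "\<one> \<in> H" using f fc by (auto simp: H_def set_mult_def intro!: bexI[of _ f])
  have stab: "{x} <#> H = H" if "x \<in> H" for x
  proof -
    have xc: "x \<in> carrier G" using that H by auto
    let ?Z = "{f} <#> ({x} <#> H)"
    have xH: "{x} <#> H \<subseteq> carrier G" "card ({x} <#> H) = card F"
        "card (({x} <#> H) <#> B) = card (F <#> B)"
      using tr[OF xc H(1)] H by auto
    have Z: "?Z \<subseteq> carrier G" "card ?Z = card F" "card (?Z <#> B) = card (F <#> B)"
      using tr[OF fc xH(1)] xH by auto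
    have "f \<otimes> x \<in> F" using that by (subst FH) (auto simp: set_mult_def)
    moreover have "f \<otimes> x \<in> ?Z" using oneH xc by (force simp: set_mult_def)
    ultimately have "?Z = F" using atoms[OF Z] by blast
    then have eq: "{f} <#> ({x} <#> H) = {f} <#> H" using FH by simp
    have "y \<in> {x} <#> H \<longleftrightarrow> y \<in> H" if "y \<in> carrier G" for y
    proof -
      have *: "y \<in> Y \<longleftrightarrow> f \<otimes> y \<in> {f} <#> Y" if "Y \<subseteq> carrier G" for Y
        using that \<open>y \<in> carrier G\<close> fc by (auto simp: set_mult_def subset_iff)
      show ?thesis using *[OF xH(1)] *[OF H(1)] eq by simp
    qed
    then show ?thesis using xH(1) H(1) by blast
  qed
  have "subgroup H G"
  proof (rule subgroupI)
    show "H \<subseteq> carrier G" by fact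
    show "H \<noteq> {}" using oneH by auto
    show "inv a \<in> H" if "a \<in> H" for a
    proof -
      have "\<one> \<in> {a} <#> H" using stab[OF that] oneH by simp
      then obtain y where y: "y \<in> H" "\<one> = a \<otimes> y" by (auto simp: set_mult_def)
      then have "inv a = y" using H(1) that by (metis inv_unique' m_comm subsetD)
      then show ?thesis using y by simp
    qed
    show "a \<otimes> b \<in> H" if "a \<in> H" "b \<in> H" for a b
    proof -
      have "a \<otimes> b \<in> {a} <#> H" using that by (auto simp: set_mult_def)
      then show ?thesis using stab that by simp
    qed
  qed
  moreover have "H <#> B \<noteq> carrier G"
    using H(3) Fc(3) finXB[OF Fc(1)] fin by (metis card_seteq order_refl)
  moreover have "card (H <#> B) + card X\<^sub>0 \<le> card (X\<^sub>0 <#> B) + card H"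
    using dF[OF \<open>adm X\<^sub>0\<close>] le[OF Fc(1)] le[OF X0(1)] H(2,3) unfolding d_def by linarith
  ultimately show ?thesis by blast
qed

text \<open>
  It is enough to bound the growth of a subgroup \<open>H\<close> with \<open>H B\<close> proper. Since \<open>B\<close> generates the
  group, it is not contained in \<open>H\<close>, so \<open>H B\<close> contains \<open>H\<close> and a second coset; therefore
  \<open>|H B| - |H| \<ge> |H B| / 2 \<ge> |B| / 2\<close>.
\<close>

lemma (in comm_group) product_with_generating_set_grows:
  assumes fin: "finite (carrier G)" and B: "B \<subseteq> carrier G" "\<one> \<in> B"
    and gen: "generate G B = carrier G"
    and X: "X \<subseteq> carrier G" "X \<noteq> {}" "X <#> B \<noteq> carrier G"
  shows "2 * card X + card B \<le> 2 * card (X <#> B)"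
proof -
  have "B \<noteq> {}" using B by auto
  from minimal_growth_attained_by_subgroup[OF fin B(1) this X]
  obtain H where H: "subgroup H G" "H <#> B \<noteq> carrier G"
      "card (H <#> B) + card X \<le> card (X <#> B) + card H"
    by blast
  have Hc: "H \<subseteq> carrier G" "\<one> \<in> H" using H(1) by (auto simp: subgroup_def)
  have finH: "finite H" using Hc fin finite_subset by auto
  have fHB: "finite (H <#> B)" "H <#> B \<subseteq> carrier G"
    using set_mult_closed[OF Hc(1) B(1)] fin finite_subset by auto
  have HHB: "H \<subseteq> H <#> B" using B Hc by (force simp: set_mult_def)
  have BHB: "B \<subseteq> H <#> B" using B Hc by (force simp: set_mult_def)
  have "\<not> B \<subseteq> H"
  proof
    assume "B \<subseteq> H"
    then have "carrier G \<subseteq> H" using generate_subgroup_incl[OF _ H(1)] gen by auto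
    then show False using HHB H(2) fHB by auto
  qed
  then obtain b where b: "b \<in> B" "b \<notin> H" by auto
  have bc: "b \<in> carrier G" using b B by auto
  have "2 * card H \<le> card (H <#> B)"
  proof -
    let ?C = "(\<lambda>h. h \<otimes> b) ` H"
    have "card ?C = card H" using Hc bc by (intro card_image) (auto simp: inj_on_def subset_iff)
    moreover have "H \<inter> ?C = {}"
    proof -
      have False if "h \<in> H" "h \<otimes> b \<in> H" for h
      proof -
        have "inv h \<otimes> (h \<otimes> b) \<in> H"
          using that H(1) by (simp add: subgroup.m_closed subgroup.m_inv_closed)
        then show False using b that Hc bc by (auto simp flip: m_assoc simp: subset_iff)
      qed
      then show ?thesis by blast
    qed
    moreover have "H \<union> ?C \<subseteq> H <#> B" using HHB b by (auto simp: set_mult_def)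
    ultimately show ?thesis
      using card_mono[OF fHB(1)] finH by (metis card_Un_disjoint finite_imageI mult_2)
  qed
  moreover have "card B \<le> card (H <#> B)" using BHB fHB by (auto intro: card_mono)
  ultimately show ?thesis using H(3) by linarith
qed

section \<open>Powers of a set\<close>

lemma (in comm_monoid) prod_power_0: "prod_power G A 0 = {\<one>}"
  by (auto simp: prod_power_def)

lemma (in comm_monoid) prod_power_Suc:
  assumes "A \<subseteq> carrier G"
  shows "prod_power G A (Suc k) = prod_power G A k <#> A"
proof -
  have split: "(\<Otimes>i\<in>{1..Suc k}. a i) = (\<Otimes>i\<in>{1..k}. a i) \<otimes> a (Suc k)"
    if "a \<in> {1..Suc k} \<rightarrow> A" for a
  proof -
    have "{1..Suc k} = insert (Suc k) {1..k}" by auto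
    moreover have "(\<Otimes>i\<in>insert (Suc k) {1..k}. a i) = a (Suc k) \<otimes> (\<Otimes>i\<in>{1..k}. a i)"
      using that assms by (intro finprod_insert) (auto simp: Pi_iff subset_iff)
    moreover have "a (Suc k) \<in> carrier G" "(\<Otimes>i\<in>{1..k}. a i) \<in> carrier G"
      using that assms by (auto intro!: finprod_closed simp: Pi_iff subset_iff)
    ultimately show ?thesis by (simp add: m_comm)
  qed
  show ?thesis
  proof (intro equalityI subsetI)
    fix x assume "x \<in> prod_power G A (Suc k)"
    then obtain a where a: "a \<in> {1..Suc k} \<rightarrow> A" "x = (\<Otimes>i\<in>{1..Suc k}. a i)"
      by (auto simp: prod_power_def)
    have "a \<in> {1..k} \<rightarrow> A" "a (Suc k) \<in> A" using a(1) by auto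
    then show "x \<in> prod_power G A k <#> A"
      unfolding set_mult_def prod_power_def a(2) split[OF a(1)] by blast
  next
    fix x assume "x \<in> prod_power G A k <#> A"
    then obtain a y where a: "a \<in> {1..k} \<rightarrow> A" "y \<in> A" "x = (\<Otimes>i\<in>{1..k}. a i) \<otimes> y"
      by (auto simp: prod_power_def set_mult_def)
    define b where "b = a(Suc k := y)"
    have b: "b \<in> {1..Suc k} \<rightarrow> A" using a by (auto simp: b_def Pi_iff)
    have "(\<Otimes>i\<in>{1..k}. b i) = (\<Otimes>i\<in>{1..k}. a i)"
      using a(1) assms by (intro finprod_cong') (auto simp: b_def Pi_iff subset_iff)
    then have "x = (\<Otimes>i\<in>{1..Suc k}. b i)" using split[OF b] a by (simp add: b_def)
    then show "x \<in> prod_power G A (Suc k)" using b by (auto simp: prod_power_def)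
  qed
qed

lemma (in comm_monoid) prod_power_subset:
  assumes "A \<subseteq> H" "submonoid H G"
  shows "prod_power G A k \<subseteq> H"
proof -
  have Ac: "A \<subseteq> carrier G" using assms by (auto simp: submonoid_def)
  show ?thesis
  proof (induction k)
    case 0
    then show ?case using assms by (simp add: prod_power_0 submonoid_def)
  next
    case (Suc k)
    then show ?case
      using assms by (auto simp: prod_power_Suc[OF Ac] set_mult_def submonoid_def subset_iff)
  qed
qed

lemma (in comm_monoid) prod_power_mono:
  assumes "A \<subseteq> carrier G" "\<one> \<in> A" "k \<le> l"
  shows "prod_power G A k \<subseteq> prod_power G A l"
  using assms(3)
proof (induction rule: dec_induct)
  case (step l)
  have "submonoid (carrier G) G" by unfold_locales auto
  then have "prod_power G A l \<subseteq> carrier G" using assms(1) by (rule prod_power_subset[rotated])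
  then have "prod_power G A l \<subseteq> prod_power G A l <#> A"
    using assms(2) by (force simp: set_mult_def)
  then show ?case using step by (simp add: prod_power_Suc[OF assms(1)])
qed auto

lemma (in comm_monoid) prod_power_2:
  assumes "A \<subseteq> carrier G"
  shows "prod_power G A 2 = A <#> A"
proof -
  have "{\<one>} <#> A = A" using assms by (force simp: set_mult_def subset_iff)
  then show ?thesis
    using prod_power_Suc[OF assms, of 0] prod_power_Suc[OF assms, of 1]
    by (simp add: prod_power_0 numeral_2_eq_2)
qed

section \<open>Incidences between points and lines\<close>

text \<open>
  The number \<open>r x\<close> of lines through a point \<open>x\<close> has mean \<open>c = |L| / q\<close> over the plane \<open>\<Omega>\<close>. As two
  lines share at most one point, the second moment of \<open>r\<close> is at most \<open>|L| (q + |L|)\<close>, so the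
  sum of \<open>(r x - c)\<^sup>2\<close> over \<open>\<Omega>\<close> is at most \<open>q |L|\<close>; Cauchy-Schwarz on \<open>T\<close> transfers this to
  incidences.
\<close>

lemma incidence_bound:
  fixes l :: "'i \<Rightarrow> 'a set" and q :: nat
  assumes fin: "finite L" "finite \<Omega>" and q: "q > 0" "card \<Omega> = q * q"
    and line: "\<And>i. i \<in> L \<Longrightarrow> l i \<subseteq> \<Omega>" "\<And>i. i \<in> L \<Longrightarrow> card (l i) = q"
    and meet: "\<And>i j. i \<in> L \<Longrightarrow> j \<in> L \<Longrightarrow> i \<noteq> j \<Longrightarrow> card (l i \<inter> l j) \<le> 1"
    and T: "T \<subseteq> \<Omega>"
  shows "((\<Sum>i\<in>L. real (card (l i \<inter> T))) - real (card T) * real (card L) / real q)\<^sup>2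
    \<le> real q * real (card T) * real (card L)"
proof -
  define r where "r x = (\<Sum>i\<in>L. of_bool (x \<in> l i) :: real)" for x
  define c where "c = real (card L) / real q"
  have finT: "finite T" using T fin finite_subset by auto
  have count: "(\<Sum>x\<in>U. of_bool (x \<in> V) :: real) = real (card (V \<inter> U))" if "finite U" for U V :: "'a set"
    using that by (simp add: of_bool_def sum.If_cases Int_commute)
  have r_sum: "sum r U = (\<Sum>i\<in>L. real (card (l i \<inter> U)))" if "finite U" for U
    unfolding r_def by (subst sum.swap) (simp add: count[OF that])
  have "sum r \<Omega> = (\<Sum>i\<in>L. real q)"
    unfolding r_sum[OF fin(2)] using line by (intro sum.cong) (auto simp: Int_absorb2)
  then have r1: "sum r \<Omega> = real (card L) * real q" by simp
  have r2: "(\<Sum>x\<in>\<Omega>. (r x)\<^sup>2) \<le> real (card L) * (real q + real (card L))"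
  proof -
    have "(\<Sum>x\<in>\<Omega>. (r x)\<^sup>2) = (\<Sum>x\<in>\<Omega>. \<Sum>i\<in>L. \<Sum>j\<in>L. of_bool (x \<in> l i \<inter> l j))"
      unfolding r_def power2_eq_square sum_product by (intro sum.cong) auto
    also have "\<dots> = (\<Sum>i\<in>L. \<Sum>x\<in>\<Omega>. \<Sum>j\<in>L. of_bool (x \<in> l i \<inter> l j))" by (rule sum.swap)
    also have "\<dots> = (\<Sum>i\<in>L. \<Sum>j\<in>L. \<Sum>x\<in>\<Omega>. of_bool (x \<in> l i \<inter> l j))"
      by (intro sum.cong refl sum.swap)
    also have "\<dots> = (\<Sum>i\<in>L. \<Sum>j\<in>L. real (card (l i \<inter> l j \<inter> \<Omega>)))"
      by (simp only: count[OF fin(2)])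
    also have "\<dots> \<le> (\<Sum>i\<in>L. \<Sum>j\<in>L. (if i = j then real q else 0) + 1)"
    proof (intro sum_mono)
      fix i j assume ij: "i \<in> L" "j \<in> L"
      have "l i \<inter> l j \<inter> \<Omega> = l i \<inter> l j" using line(1)[OF ij(1)] by auto
      then show "real (card (l i \<inter> l j \<inter> \<Omega>)) \<le> (if i = j then real q else 0) + 1"
        using meet[OF ij] line(2)[OF ij(1)] by auto
    qed
    also have "\<dots> = real (card L) * (real q + real (card L))"
      using fin by (simp add: sum.distrib algebra_simps)
    finally show ?thesis .
  qed
  have "(\<Sum>x\<in>\<Omega>. (r x - c)\<^sup>2) = (\<Sum>x\<in>\<Omega>. (r x)\<^sup>2) - 2 * c * sum r \<Omega> + real (card \<Omega>) * c\<^sup>2"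
    by (simp add: power2_diff sum.distrib sum_subtractf algebra_simps
        flip: sum_distrib_left sum_distrib_right)
  also have "\<dots> \<le> real (card L) * (real q + real (card L)) - 2 * c * (real (card L) * real q)
      + real (card \<Omega>) * c\<^sup>2"
    using r1 r2 by simp
  also have "\<dots> = real q * real (card L)"
    using q by (simp add: c_def field_simps power2_eq_square)
  finally have var: "(\<Sum>x\<in>\<Omega>. (r x - c)\<^sup>2) \<le> real q * real (card L)" .
  have "(\<Sum>i\<in>L. real (card (l i \<inter> T))) - real (card T) * real (card L) / real q
      = (\<Sum>x\<in>T. r x - c)"
    by (simp add: sum_subtractf r_sum[OF finT] c_def)
  also have "\<dots>\<^sup>2 \<le> (\<Sum>x\<in>T. (r x - c)\<^sup>2) * real (card T)"
    by (rule sum_squared_le_sum_of_squares)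
  also have "(\<Sum>x\<in>T. (r x - c)\<^sup>2) \<le> (\<Sum>x\<in>\<Omega>. (r x - c)\<^sup>2)"
    using T fin by (intro sum_mono2) auto
  also note var
  finally show ?thesis by (simp add: mult_right_mono mult_ac)
qed

text \<open>
  This is \<open>incidence_bound\<close> for the lines \<open>{(s, (s - a) b)}\<close> with \<open>a, b \<in> A\<close> and the points of
  \<open>(A + A) \<times> (A A)\<close>, divided by \<open>n\<close>.
\<close>

lemma (in field) sum_product_bound:
  assumes fin: "finite (carrier R)" and A: "A \<subseteq> carrier R - {\<zero>}"
  defines "q \<equiv> real (card (carrier R))" and "n \<equiv> real (card A)"
    and "m \<equiv> real (card (A <+>\<^bsub>R\<^esub> A)) * real (card (A <#> A))"
  shows "n\<^sup>2 \<le> n * m / q + sqrt (q * m)"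
proof (cases "A = {}")
  case True
  then show ?thesis by (simp add: n_def m_def set_mult_def)
next
  case False
  define l where "l = (\<lambda>(a, b). (\<lambda>s. (s, (s \<ominus> a) \<otimes> b)) ` carrier R)"
  let ?\<Omega> = "carrier R \<times> carrier R" and ?T = "(A <+>\<^bsub>R\<^esub> A) \<times> (A <#> A)" and ?L = "A \<times> A"
  have Ac: "a \<in> carrier R" "a \<noteq> \<zero>" if "a \<in> A" for a using that A by auto
  have finA: "finite A" using A fin by (metis finite_Diff finite_subset)
  have npos: "n > 0" using False finA by (simp add: n_def card_gt_0_iff)
  have qpos: "card (carrier R) > 0" using fin by (auto simp: card_gt_0_iff)
  have meet: "card (l i \<inter> l j) \<le> 1" if ij: "i \<in> ?L" "j \<in> ?L" "i \<noteq> j" for i j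
  proof -
    obtain a b a' b' where e: "i = (a, b)" "j = (a', b')" by (metis surj_pair)
    have c: "a \<in> carrier R" "b \<in> carrier R" "a' \<in> carrier R" "b' \<in> carrier R" "b \<noteq> \<zero>"
      using ij Ac by (auto simp: e)
    have "s = t" if s: "s \<in> carrier R" "(s \<ominus> a) \<otimes> b = (s \<ominus> a') \<otimes> b'"
        and t: "t \<in> carrier R" "(t \<ominus> a) \<otimes> b = (t \<ominus> a') \<otimes> b'" for s t
    proof (rule ccontr)
      assume "s \<noteq> t"
      have "(s \<ominus> t) \<otimes> b = (s \<ominus> a) \<otimes> b \<ominus> (t \<ominus> a) \<otimes> b" using c s(1) t(1) by algebra
      also have "\<dots> = (s \<ominus> a') \<otimes> b' \<ominus> (t \<ominus> a') \<otimes> b'" using s(2) t(2) by simp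
      also have "\<dots> = (s \<ominus> t) \<otimes> b'" using c s(1) t(1) by algebra
      finally have "(s \<ominus> t) \<otimes> b = (s \<ominus> t) \<otimes> b'" .
      moreover have "s \<ominus> t \<noteq> \<zero>" using \<open>s \<noteq> t\<close> s(1) t(1) by simp
      ultimately have b: "b = b'" using c s(1) t(1) by (simp add: m_lcancel)
      then have "s \<ominus> a = s \<ominus> a'" using s c by (simp add: m_rcancel)
      moreover have "a = s \<ominus> (s \<ominus> a)" "a' = s \<ominus> (s \<ominus> a')" using s(1) c by algebra+
      ultimately show False using b ij(3) e by metis
    qed
    then have "x = y" if "x \<in> l i \<inter> l j" "y \<in> l i \<inter> l j" for x y
      using that by (force simp: l_def e)
    moreover have "finite (l i \<inter> l j)" using fin by (auto simp: l_def e)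
    ultimately show ?thesis by (metis One_nat_def card_le_Suc0_iff_eq)
  qed
  have inc: "real (card A) \<le> real (card (l i \<inter> ?T))" if i: "i \<in> ?L" for i
  proof -
    obtain a b where e: "i = (a, b)" "a \<in> A" "b \<in> A" using i by auto
    have "inj_on (\<lambda>x. (a \<oplus> x, x \<otimes> b)) A"
      using Ac e by (intro inj_onI) (simp add: m_rcancel)
    moreover have "(\<lambda>x. (a \<oplus> x, x \<otimes> b)) ` A \<subseteq> l i \<inter> ?T"
    proof (intro image_subsetI)
      fix x assume x: "x \<in> A"
      have "(a \<oplus> x) \<ominus> a = x" using Ac x e by algebra
      then show "(a \<oplus> x, x \<otimes> b) \<in> l i \<inter> ?T"
        using x e Ac by (auto simp: l_def set_mult_def set_add_def' intro!: image_eqI[of _ _ "a \<oplus> x"])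
    qed
    moreover have "finite (l i \<inter> ?T)" using fin by (simp add: l_def e)
    ultimately have "card A \<le> card (l i \<inter> ?T)" by (rule card_inj_on_le)
    then show ?thesis by simp
  qed
  have T: "?T \<subseteq> ?\<Omega>" using Ac unfolding set_mult_def set_add_def' by auto
  define I where "I = (\<Sum>i\<in>?L. real (card (l i \<inter> ?T)))"
  have "(I - real (card ?T) * real (card ?L) / real (card (carrier R)))\<^sup>2
    \<le> real (card (carrier R)) * real (card ?T) * real (card ?L)"
    unfolding I_def
  proof (rule incidence_bound[where \<Omega> = ?\<Omega>])
    fix i assume i: "i \<in> ?L"
    then obtain a b where e: "i = (a, b)" "a \<in> A" "b \<in> A" by auto
    show "l i \<subseteq> ?\<Omega>" using e Ac by (auto simp: l_def)
    show "card (l i) = card (carrier R)"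
      unfolding l_def e by (simp add: card_image inj_on_def)
    show "card (l i \<inter> l j) \<le> 1" if "j \<in> ?L" "i \<noteq> j" for j
      using meet i that by blast
  qed (use fin finA qpos T in \<open>simp_all add: card_cartesian_product\<close>)
  then have "(I - m * n\<^sup>2 / q)\<^sup>2 \<le> q * m * n\<^sup>2"
    by (simp add: card_cartesian_product m_def n_def q_def power2_eq_square)
  then have "I - m * n\<^sup>2 / q \<le> sqrt (q * m * n\<^sup>2)" by (rule real_le_rsqrt)
  moreover have "n * n\<^sup>2 \<le> I"
  proof -
    have "(\<Sum>i\<in>?L. real (card A)) \<le> I" unfolding I_def by (intro sum_mono inc)
    then show ?thesis by (simp add: n_def power2_eq_square card_cartesian_product mult.assoc)
  qed
  moreover have "sqrt (q * m * n\<^sup>2) = n * sqrt (q * m)"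
    using npos by (simp add: real_sqrt_mult)
  ultimately have "n * n\<^sup>2 \<le> n * (n * m / q + sqrt (q * m))"
    by (simp add: power2_eq_square algebra_simps)
  then show ?thesis using npos by simp
qed

text \<open>
  If \<open>|A A| \<le> q / (2 K)\<close>, then \<open>n \<le> |A A|\<close> forces \<open>K n \<le> q / 2\<close>, which turns the hypothesis
  \<open>q\<^sup>3 < K n\<^sup>4\<close> into \<open>2 q\<^sup>2 < n\<^sup>3\<close>. This is exactly what contradicts \<open>sum_product_bound\<close>.
\<close>

lemma (in field) product_set_large:
  fixes K :: real
  assumes fin: "finite (carrier R)" and A: "A \<subseteq> carrier R - {\<zero>}" and K: "K > 0"
    and sum: "real (card (A <+>\<^bsub>R\<^esub> A)) = K * real (card A)"
    and large: "real (card (carrier R)) ^ 3 < K * real (card A) ^ 4"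
  shows "real (card (A <#> A)) > real (card (carrier R)) / (2 * K)"
proof (rule ccontr)
  define n q P where "n = real (card A)" and "q = real (card (carrier R))"
    and "P = real (card (A <#> A))"
  assume "\<not> ?thesis"
  then have P: "P \<le> q / (2 * K)" by (simp add: P_def q_def)
  have finA: "finite A" using A fin by (metis finite_Diff finite_subset)
  have large': "q ^ 3 < K * n ^ 4" using large by (simp add: n_def q_def)
  have qpos: "q > 0" using fin by (auto simp: q_def card_gt_0_iff)
  have npos: "n > 0"
  proof (rule ccontr)
    assume "\<not> n > 0"
    then have "n = 0" by (simp add: n_def)
    then show False using large' qpos by simp
  qed
  have ne: "A \<noteq> {}" using npos by (auto simp: n_def)
  have nP: "n \<le> P"
  proof -
    obtain b where b: "b \<in> A" using ne by auto
    have "inj_on (\<lambda>x. x \<otimes> b) A" using A b by (intro inj_onI) (auto simp: m_rcancel subset_iff)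
    moreover have "(\<lambda>x. x \<otimes> b) ` A \<subseteq> A <#> A" using b by (auto simp: set_mult_def)
    moreover have "finite (A <#> A)" using finA by (simp add: set_mult_def)
    ultimately have "card A \<le> card (A <#> A)" by (rule card_inj_on_le)
    then show ?thesis by (simp add: n_def P_def)
  qed
  have KP: "K * P \<le> q / 2" using P K by (simp add: field_simps)
  have Kn: "K * n \<le> q / 2" using nP KP K by (metis mult_left_mono order_trans less_imp_le)
  have "q ^ 3 < (K * n) * n ^ 3" using large' by (simp add: power_numeral_reduce mult_ac)
  also have "\<dots> \<le> (q / 2) * n ^ 3" using Kn npos by (intro mult_right_mono) auto
  finally have "q * (2 * q\<^sup>2) < q * n ^ 3" by (simp add: power_numeral_reduce)
  then have n3: "2 * q\<^sup>2 < n ^ 3" using qpos by simp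
  define m where "m = K * n * P"
  have m: "m \<le> n * q / 2"
    using mult_left_mono[OF KP, of n] npos by (simp add: m_def mult_ac)
  have "n\<^sup>2 \<le> n * m / q + sqrt (q * m)"
    using sum_product_bound[OF fin A] sum by (simp add: n_def q_def m_def P_def)
  also have "\<dots> \<le> n * (n * q / 2) / q + sqrt (q * (n * q / 2))"
    using m npos qpos
    by (intro add_mono divide_right_mono mult_left_mono real_sqrt_le_mono) auto
  also have "\<dots> = n\<^sup>2 / 2 + sqrt (q\<^sup>2 * n / 2)"
    using qpos by (simp add: power2_eq_square mult_ac)
  finally have "n\<^sup>2 / 2 \<le> sqrt (q\<^sup>2 * n / 2)" by simp
  then have "(n\<^sup>2 / 2)\<^sup>2 \<le> (sqrt (q\<^sup>2 * n / 2))\<^sup>2"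
    by (intro power_mono) auto
  then have "(n\<^sup>2 / 2)\<^sup>2 \<le> q\<^sup>2 * n / 2"
    using npos by simp
  then have "n * n ^ 3 \<le> n * (2 * q\<^sup>2)" by (simp add: power_numeral_reduce mult_ac)
  then show False using n3 npos by simp
qed

section \<open>Reaching the generated subgroup\<close>

text \<open>
  Steps of two factors are used because the set that is known to be large is \<open>A A\<close> and not \<open>A\<close>.
  Each step adds at least \<open>|A A| / 2\<close> elements, and the first already has \<open>|A A|\<close>; this is where
  \<open>m + 1\<close> comes from.
\<close>

lemma (in comm_group) prod_power_eq_carrier:
  assumes fin: "finite (carrier G)" and A: "A \<subseteq> carrier G" "\<one> \<in> A"
    and gen: "generate G A = carrier G"
    and m: "m > 0" "2 * card (carrier G) < (m + 1) * card (A <#> A)"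
  shows "prod_power G A (2 * m) = carrier G"
proof -
  let ?P = "\<lambda>j. prod_power G A (2 * j)" and ?B = "A <#> A"
  have Bc: "?B \<subseteq> carrier G" by (rule set_mult_closed[OF A(1) A(1)])
  have "a \<in> ?B" if "a \<in> A" for a
    using that A r_one[of a] unfolding set_mult_def by blast
  then have "A \<subseteq> ?B" by blast
  then have B: "?B \<subseteq> carrier G" "\<one> \<in> ?B" using A Bc by auto
  have genB: "generate G ?B = carrier G"
    using mono_generate[OF \<open>A \<subseteq> ?B\<close>] gen generate_incl[OF B(1)] by auto
  have "submonoid (carrier G) G" by unfold_locales auto
  then have Pc: "prod_power G A k \<subseteq> carrier G" for k using A(1) prod_power_subset by blast
  have one: "\<one> \<in> prod_power G A k" for k
    using prod_power_mono[OF A, of 0 k] by (simp add: prod_power_0)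
  have step: "?P (Suc j) = ?P j <#> ?B" for j
    using prod_power_Suc[OF A(1)] Pc A by (simp add: set_mult_assoc)
  have grow: "?P j = carrier G \<or> (j + 1) * card ?B \<le> 2 * card (?P j)" if "j \<ge> 1" for j
    using that
  proof (induction rule: dec_induct)
    case base
    then show ?case using prod_power_2[OF A(1)] by simp
  next
    case (step j)
    show ?case
    proof (cases "?P (Suc j) = carrier G")
      case False
      have "?P j \<noteq> carrier G"
        using False Pc[of "2 * Suc j"] prod_power_mono[OF A, of "2 * j" "2 * Suc j"] by auto
      then have "(j + 1) * card ?B \<le> 2 * card (?P j)" using step by auto
      moreover have "2 * card (?P j) + card ?B \<le> 2 * card (?P (Suc j))"
        unfolding \<open>\<And>j. ?P (Suc j) = ?P j <#> ?B\<close>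
        using product_with_generating_set_grows[OF fin B genB Pc] one[of "2 * j"] False
          \<open>\<And>j. ?P (Suc j) = ?P j <#> ?B\<close> by auto
      ultimately show ?thesis by (simp add: algebra_simps)
    qed simp
  qed
  have "card (?P m) \<le> card (carrier G)" using Pc fin by (rule card_mono[rotated])
  then show ?thesis using grow[of m] m by auto
qed

lemma (in comm_group) prod_power_eq_generate:
  assumes fin: "finite (carrier G)" and A: "A \<subseteq> carrier G" "\<one> \<in> A"
    and m: "m > 0" "2 * card (carrier G) < (m + 1) * card (A <#> A)" and k: "2 * m \<le> k"
  shows "prod_power G A k = generate G A"
proof -
  let ?H = "generate G A"
  have sub: "subgroup ?H G" by (rule generate_is_subgroup[OF A(1)])
  have AH: "A \<subseteq> ?H" by (auto intro: generate.incl)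
  interpret H: comm_group "G\<lparr>carrier := ?H\<rparr>"
    using submonoid_is_comm_monoid[OF subgroup_is_submonoid[OF sub]] subgroup_imp_group[OF sub]
    by (simp add: comm_group_def)
  have Hc: "?H \<subseteq> carrier G" using sub by (rule subgroup.subset)
  have same: "prod_power (G\<lparr>carrier := ?H\<rparr>) A j = prod_power G A j" for j
  proof (induction j)
    case 0
    show ?case using H.prod_power_0 prod_power_0 by simp
  next
    case (Suc j)
    then show ?case using H.prod_power_Suc[of A j] prod_power_Suc[OF A(1), of j] AH by simp
  qed
  have "prod_power (G\<lparr>carrier := ?H\<rparr>) A (2 * m) = carrier (G\<lparr>carrier := ?H\<rparr>)"
  proof (rule H.prod_power_eq_carrier)
    show "generate (G\<lparr>carrier := ?H\<rparr>) A = carrier (G\<lparr>carrier := ?H\<rparr>)"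
      using generate_consistent[OF AH sub] by simp
    have "card ?H \<le> card (carrier G)" using Hc fin by (rule card_mono[rotated])
    then show "2 * card (carrier (G\<lparr>carrier := ?H\<rparr>))
      < (m + 1) * card (A <#>\<^bsub>G\<lparr>carrier := ?H\<rparr>\<^esub> A)"
      using m(2) by simp
  qed (use A AH m Hc fin finite_subset in auto)
  then have "?H \<subseteq> prod_power G A k"
    using same prod_power_mono[OF A k] by simp
  moreover have "prod_power G A k \<subseteq> ?H"
    by (rule prod_power_subset[OF AH subgroup_is_submonoid[OF sub]])
  ultimately show ?thesis by blast
qed

theorem theorem5p1:
  fixes p :: nat and A :: "int set" and K :: real
  assumes "prime p"
    and "A \<subseteq> carrier (Fp_star p)"
    and "\<one>\<^bsub>Fp_star p\<^esub> \<in> A"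
    and "K > 0"
    and "real (card (A <+>\<^bsub>Fp p\<^esub> A)) = K * real (card A)"
    and "real (card A) > real p powr (3/4) / K powr (1/4)"
  shows "real (card (prod_power (Fp_star p) A 3)) > real p / (2 * K) \<and>
    (\<exists>G. subgroup G (Fp_star p) \<and> prod_power (Fp_star p) A (nat \<lceil>12 * K\<rceil>) = G) \<and>
    (generating (Fp_star p) A \<longrightarrow>
      prod_power (Fp_star p) A (nat \<lceil>12 * K\<rceil>) = carrier (Fp_star p))"
proof -
  interpret res: residues_prime p "Fp p"
    using assms(1) by unfold_locales auto
  interpret Fs: group "Fp_star p" by (rule res.field_mult_group)
  interpret Fs: comm_group "Fp_star p"
    by (rule Fs.group_comm_groupI) (auto intro: res.m_comm)
  have p: "p > 0" using assms(1) prime_gt_0_nat by blast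
  have carr: "carrier (Fp p) = {0..int p - 1}" by (simp add: residue_ring_def)
  then have cardF: "finite (carrier (Fp p))" "card (carrier (Fp p)) = p" by auto
  have A: "A \<subseteq> carrier (Fp p) - {\<zero>\<^bsub>Fp p\<^esub>}" using assms(2) by simp
  have finA: "finite A" using A cardF by (metis finite_Diff finite_subset)
  define n where "n = real (card A)"
  have npos: "n > 0" using finA assms(3) by (auto simp: n_def card_gt_0_iff)
  have mult_eq: "A <#>\<^bsub>Fp_star p\<^esub> A = A <#>\<^bsub>Fp p\<^esub> A" by (simp add: set_mult_def)
  have large: "real p ^ 3 < K * n ^ 4"
  proof -
    have "real p powr (3/4) < n * K powr (1/4)"
      using assms(4,6) by (simp add: n_def field_simps)
    then have "(real p powr (3/4)) ^ 4 < (n * K powr (1/4)) ^ 4"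
      by (intro power_strict_mono) auto
    moreover have "(real p powr (3/4)) ^ 4 = real p ^ 3"
      using p by (simp add: powr_power powr_numeral)
    moreover have "(K powr (1/4)) ^ 4 = K"
      using assms(4) by (simp add: powr_power)
    ultimately show ?thesis by (simp add: power_mult_distrib mult.commute)
  qed
  let ?B = "A <#>\<^bsub>Fp_star p\<^esub> A"
  have B: "real p / (2 * K) < real (card ?B)"
    using res.product_set_large[OF cardF(1) A assms(4,5)] large cardF mult_eq
    by (simp add: n_def)
  have finStar: "finite (carrier (Fp_star p))" using cardF by simp
  have finPow: "finite (prod_power (Fp_star p) A k)" for k
    using Fs.prod_power_subset[OF assms(2) subgroup_is_submonoid[OF Fs.subgroup_self]]
      finStar finite_subset by blast
  have "?B \<subseteq> prod_power (Fp_star p) A 3"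
    using Fs.prod_power_2[OF assms(2)] Fs.prod_power_mono[OF assms(2,3), of 2 3] by simp
  then have cube: "real p / (2 * K) < real (card (prod_power (Fp_star p) A 3))"
    using B card_mono[OF finPow] by (meson less_le_trans of_nat_le_iff)
  have K1: "K \<ge> 1"
  proof -
    have "card A \<le> card (A <+>\<^bsub>Fp p\<^esub> A)"
    proof -
      obtain b where b: "b \<in> A" using assms(3) by auto
      have "inj_on (\<lambda>x. x \<oplus>\<^bsub>Fp p\<^esub> b) A" using A b by (intro inj_onI) (auto simp: subset_iff)
      moreover have "(\<lambda>x. x \<oplus>\<^bsub>Fp p\<^esub> b) ` A \<subseteq> A <+>\<^bsub>Fp p\<^esub> A"
        using b by (auto simp: set_add_def')
      moreover have "finite (A <+>\<^bsub>Fp p\<^esub> A)" using finA by (simp add: set_add_def')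
      ultimately show ?thesis by (rule card_inj_on_le)
    qed
    then have "n \<le> K * n" using assms(5) by (simp add: n_def flip: of_nat_le_iff)
    then show ?thesis using npos by simp
  qed
  define m where "m = nat \<lceil>4 * K\<rceil>"
  have mK: "4 * K \<le> real m" "real m < 4 * K + 1" using K1 unfolding m_def by linarith+
  have "prod_power (Fp_star p) A (nat \<lceil>12 * K\<rceil>) = generate (Fp_star p) A"
  proof (rule Fs.prod_power_eq_generate[OF finStar assms(2,3)])
    show "m > 0" using mK K1 by linarith
    have "real (2 * m) \<le> 12 * K" using mK K1 by simp
    then show "2 * m \<le> nat \<lceil>12 * K\<rceil>" by linarith
    have "card (carrier (Fp_star p)) \<le> p"
      using cardF card_mono[OF cardF(1), of "carrier (Fp_star p)"] by auto
    then have "real (2 * card (carrier (Fp_star p))) \<le> (4 * K) * (real p / (2 * K))"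
      using assms(4) by simp
    also have "\<dots> < (4 * K) * real (card ?B)" using B assms(4) by (intro mult_strict_left_mono) auto
    also have "\<dots> \<le> real (m + 1) * real (card ?B)" using mK by (intro mult_right_mono) auto
    also have "\<dots> = real ((m + 1) * card ?B)" by (rule of_nat_mult[symmetric])
    finally show "2 * card (carrier (Fp_star p)) < (m + 1) * card ?B"
      by (simp only: of_nat_less_iff)
  qed
  then show ?thesis
    using cube Fs.generate_is_subgroup[OF assms(2)] by (auto simp: generating_def)
qed

end
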